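(* Let $\phi(t)=\frac{1}{1+e^{-t}}$ be the sigmoidal transfer function. Let $\eta>0$ and let $F_{\theta^0}(x)=\beta^0+\sum_{i=1}^{k^0}a_i^0\phi({w_i^0}^Tx)$ be a minimal MLP function with $k^0$ hidden units (i.e. $k^0$ is the smallest number of hidden units with which this function can be represented), with $\Vert w_i^0\Vert\ge\eta$ and $a_i^0\ge\eta$ for all $i\in\{1,\dots,k^0\}$. Let $q\lambda_d$ be a probability measure on $\mathbb R^d$ with $q(x)>0$ for all $x\in\mathbb R^d$ and $\int\Vert x\Vert^6q\,d\lambda_d<\infty$. Then the functions of $(x_1,\dots,x_d)$ $$1,\quad x_lx_m\phi''({w_i^0}^Tx)\ (1\le l\le m\le d,\ 1\le i\le k^0),\quad \phi''({w_i^0}^Tx),\quad x_m\phi'({w_i^0}^Tx)\ (1\le m\le d),\quad \phi'({w_i^0}^Tx),\quad \phi({w_i^0}^Tx)\quad(1\le i\le k^0)$$ are linearly independent in $L^2(q\lambda_d)$.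
   Context: For an input with coordinates $(x_1,\dots,x_d)\in\mathbb R^d$ write $x=(1,x_1,\dots,x_d)^T\in\mathbb R^{d+1}$, and $w_i=(w_{i0},w_{i1},\dots,w_{id})^T\in\mathbb R^{d+1}$. An MLP function with $k$ hidden units is a function of the form $F_\theta(x)=\beta+\sum_{i=1}^k a_i\phi(w_i^Tx)$ with $\theta=(\beta,a_1,\dots,a_k,w_1,\dots,w_k)\in\mathbb R^{k(d+2)+1}$. Minimality of $k^0$ means that no MLP function with fewer than $k^0$ hidden units (with arbitrary real parameters) equals $F_{\theta^0}$. $\lambda_d$ is Lebesgue measure on $\mathbb R^d$ and $\Vert\cdot\Vert$ is the Euclidean norm. *)

theory Defs
  imports "HOL-Probability.Probability"
begin

definition sigmoid :: "real \<Rightarrow> real" where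
  "sigmoid t = 1 / (1 + exp (- t))"

(* real \<times> (real ^ 'd) with its product inner product and norm is Euclidean (d+1)-space:
   the first component of a weight is the bias, and ext x is the input (1, x_1, ..., x_d). *)
definition ext :: "real ^ 'd \<Rightarrow> real \<times> (real ^ 'd)" where
  "ext x = (1, x)"

(* Only the values of a and w at 1, ..., k matter. *)
definition mlp ::
  "(real \<Rightarrow> real) \<Rightarrow> nat \<Rightarrow> real \<Rightarrow> (nat \<Rightarrow> real) \<Rightarrow> (nat \<Rightarrow> real \<times> (real ^ 'd)) \<Rightarrow> real ^ 'd \<Rightarrow> real"
where
  "mlp \<phi> k \<beta> a w x = \<beta> + (\<Sum>i=1..k. a i * \<phi> (w i \<bullet> ext x))"

definition mlp_function :: "(real \<Rightarrow> real) \<Rightarrow> nat \<Rightarrow> (real ^ 'd \<Rightarrow> real) \<Rightarrow> bool" where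
  "mlp_function \<phi> k F \<longleftrightarrow> (\<exists>\<beta> a w. F = mlp \<phi> k \<beta> a w)"

definition minimal_mlp_function :: "(real \<Rightarrow> real) \<Rightarrow> nat \<Rightarrow> (real ^ 'd \<Rightarrow> real) \<Rightarrow> bool" where
  "minimal_mlp_function \<phi> k F \<longleftrightarrow> mlp_function \<phi> k F \<and> (\<forall>k'<k. \<not> mlp_function \<phi> k' F)"

definition L2 :: "'a measure \<Rightarrow> ('a \<Rightarrow> real) set" where
  "L2 M = {f \<in> borel_measurable M. integrable M (\<lambda>x. (f x)\<^sup>2)}"

(* Elements of the space of square-integrable functions are taken modulo equality almost
   everywhere, so a linear combination is the zero vector iff it vanishes almost everywhere. *)
definition lin_indep_L2 :: "'a measure \<Rightarrow> 'i set \<Rightarrow> ('i \<Rightarrow> 'a \<Rightarrow> real) \<Rightarrow> bool" where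
  "lin_indep_L2 M I f \<longleftrightarrow>
     (\<forall>j\<in>I. f j \<in> L2 M) \<and>
     (\<forall>J c. finite J \<longrightarrow> J \<subseteq> I \<longrightarrow> (AE x in M. (\<Sum>j\<in>J. c j * f j x) = 0) \<longrightarrow> (\<forall>j\<in>J. c j = 0))"

datatype 'd score_index =
    Const
  | Quad_D2 nat 'd 'd
  | D2 nat
  | Lin_D1 nat 'd
  | D1 nat
  | D0 nat

definition score_indices :: "nat \<Rightarrow> 'd::linorder score_index set" where
  "score_indices k =
     {Const}
     \<union> {Quad_D2 i l m | i l m. i \<in> {1..k} \<and> l \<le> m}
     \<union> {D2 i | i. i \<in> {1..k}}
     \<union> {Lin_D1 i m | i m. i \<in> {1..k}}
     \<union> {D1 i | i. i \<in> {1..k}}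
     \<union> {D0 i | i. i \<in> {1..k}}"

primrec score_fun ::
  "(real \<Rightarrow> real) \<Rightarrow> (nat \<Rightarrow> real \<times> (real ^ 'd)) \<Rightarrow> 'd score_index \<Rightarrow> real ^ 'd \<Rightarrow> real"
where
  "score_fun \<phi> w Const = (\<lambda>x. 1)"
| "score_fun \<phi> w (Quad_D2 i l m) = (\<lambda>x. x $ l * x $ m * deriv (deriv \<phi>) (w i \<bullet> ext x))"
| "score_fun \<phi> w (D2 i) = (\<lambda>x. deriv (deriv \<phi>) (w i \<bullet> ext x))"
| "score_fun \<phi> w (Lin_D1 i m) = (\<lambda>x. x $ m * deriv \<phi> (w i \<bullet> ext x))"
| "score_fun \<phi> w (D1 i) = (\<lambda>x. deriv \<phi> (w i \<bullet> ext x))"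
| "score_fun \<phi> w (D0 i) = (\<lambda>x. \<phi> (w i \<bullet> ext x))"

end

theory Submission
  imports Defs "HOL-Complex_Analysis.Conformal_Mappings"
begin

text \<open>Restricted to a line \<open>z \<mapsto> z u\<close> through the origin, a vanishing linear combination becomes a
  relation, in the real variable \<open>z\<close>, between functions
  \<open>(A z\<^sup>2 + C) \<phi>''(b + \<alpha> z) + (B z + D) \<phi>'(b + \<alpha> z) + e \<phi>(b + \<alpha> z)\<close> with \<open>\<alpha> = v \<bullet> u\<close>.
  By minimality, for \<open>u\<close> off finitely many hyperplanes every \<open>\<alpha>\<close> is nonzero and the pairs
  \<open>(\<alpha>, b)\<close> are distinct up to sign. The relation extends to complex \<open>z\<close>. A unit with maximal
  \<open>\<bar>\<alpha>\<bar>\<close> has poles at \<open>(\<i>\<pi>N - b)/\<alpha>\<close>, \<open>N\<close> odd, and for infinitely many \<open>N\<close> no other unit has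
  a pole there, so the polynomials in front of \<open>\<phi>''\<close>, \<open>\<phi>'\<close> and \<open>\<phi>\<close> vanish in turn. A single pole
  would not do: for \<open>b = 0\<close>, \<open>\<alpha> = 1\<close>, the combination
  \<open>(z\<^sup>2 + \<pi>\<^sup>2) \<phi>'' + 4 z \<phi>' + 2 \<phi>\<close> is regular at \<open>\<plusminus>\<i>\<pi>\<close>. Letting \<open>u\<close> vary, the quadratic and
  linear forms multiplying \<open>\<phi>''\<close> and \<open>\<phi>'\<close> vanish on a dense set, hence identically.\<close>

section \<open>The logistic sigmoid\<close>

lemma deriv_sigmoid: "deriv sigmoid t = exp (- t) / (1 + exp (- t)) ^ 2"
proof -
  have "1 + exp (- t) \<noteq> 0" by (smt (verit) exp_gt_zero)
  then show ?thesis
    unfolding sigmoid_def[abs_def]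
    by (intro DERIV_imp_deriv) (auto intro!: derivative_eq_intros simp: power2_eq_square)
qed

lemma deriv_deriv_sigmoid:
  "deriv (deriv sigmoid) t = exp (- t) * (exp (- t) - 1) / (1 + exp (- t)) ^ 3"
proof -
  have "1 + exp (- t) \<noteq> 0" by (smt (verit) exp_gt_zero)
  then show ?thesis
    unfolding deriv_sigmoid[abs_def]
    by (intro DERIV_imp_deriv)
      (auto intro!: derivative_eq_intros simp: divide_simps, simp add: algebra_simps eval_nat_numeral)
qed

text \<open>This symmetry makes units with opposite weights affinely related, so weights can be
  distinct only up to sign.\<close>

lemma sigmoid_uminus: "sigmoid (- t) = 1 - sigmoid t"
  by (simp add: sigmoid_def exp_minus divide_simps add_pos_pos) (smt (verit) exp_gt_zero)

lemma continuous_sigmoid: "continuous_on S sigmoid"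
  unfolding sigmoid_def[abs_def]
  by (intro continuous_intros) (smt (verit) exp_gt_zero)

lemma continuous_deriv_sigmoid: "continuous_on S (deriv sigmoid)"
  unfolding deriv_sigmoid[abs_def]
  by (intro continuous_intros) (smt (verit) exp_gt_zero zero_eq_power2)

lemma continuous_deriv_deriv_sigmoid: "continuous_on S (deriv (deriv sigmoid))"
  unfolding deriv_deriv_sigmoid[abs_def]
  by (intro continuous_intros) (smt (verit) exp_gt_zero power_eq_0_iff)

lemma abs_sigmoid_le_1: "\<bar>sigmoid t\<bar> \<le> 1"
  by (simp add: sigmoid_def abs_if divide_simps) (smt (verit) exp_gt_zero)

lemma abs_deriv_sigmoid_le_1: "\<bar>deriv sigmoid t\<bar> \<le> 1"
proof -
  define e where "e = exp (- t)"
  have "e > 0" by (simp add: e_def)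
  then have "e \<le> (1 + e) ^ 2" by (simp add: power2_eq_square algebra_simps)
  then show ?thesis using \<open>e > 0\<close> by (simp add: deriv_sigmoid flip: e_def)
qed

lemma abs_deriv_deriv_sigmoid_le_1: "\<bar>deriv (deriv sigmoid) t\<bar> \<le> 1"
proof -
  define e where "e = exp (- t)"
  have "e > 0" by (simp add: e_def)
  have "\<bar>e * (e - 1)\<bar> \<le> e * (1 + e)"
    using \<open>e > 0\<close> by (simp add: abs_mult)
  also have "\<dots> \<le> (1 + e) ^ 3"
    using \<open>e > 0\<close> by (simp add: power3_eq_cube algebra_simps)
  finally show ?thesis using \<open>e > 0\<close>
    by (simp add: deriv_deriv_sigmoid flip: e_def)
qed

section \<open>Ridge combinations on the real line\<close>

text \<open>The identity theorem applies because the reals accumulate at 0. It carries relations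
  known for real arguments to the complex poles.\<close>

lemma entire_zero_on_reals:
  assumes "f holomorphic_on UNIV" "\<And>x::real. f (of_real x) = 0"
  shows "f z = 0"
proof (rule analytic_continuation[OF assms(1) open_UNIV connected_UNIV, where U = \<real> and \<xi> = 0])
  show "(0::complex) islimpt \<real>"
  proof (rule islimptI)
    fix T :: "complex set" assume "0 \<in> T" "open T"
    then obtain d where "d > 0" "cball 0 d \<subseteq> T" by (meson open_contains_cball)
    then show "\<exists>y\<in>\<real>. y \<in> T \<and> y \<noteq> 0"
      by (intro bexI[of _ "of_real d"]) (auto simp: subset_iff)
  qed
qed (use assms(2) in \<open>auto elim: Reals_cases\<close>)

text \<open>Clearing denominators replaces a limit at the pole: the product is entire and zero on
  the reals, hence zero at \<open>z\<close>. There every term with the factor \<open>E z ^ k\<close>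
  drops out, leaving \<open>p z\<close> times nonzero factors.\<close>

lemma numerator_zero_at_unshared_pole:
  fixes p E :: "complex \<Rightarrow> complex" and F g :: "'i \<Rightarrow> complex \<Rightarrow> complex"
  assumes "finite J" "0 < k"
    and hol: "p holomorphic_on UNIV" "E holomorphic_on UNIV"
      "\<And>j. j \<in> J \<Longrightarrow> g j holomorphic_on UNIV" "\<And>j. j \<in> J \<Longrightarrow> F j holomorphic_on UNIV"
    and real_nz: "\<And>x::real. E (of_real x) \<noteq> 0" "\<And>j x. j \<in> J \<Longrightarrow> F j (of_real x) \<noteq> 0"
    and zero: "\<And>x::real. p x / E x ^ k + (\<Sum>j\<in>J. g j x / F j x) + c = 0"
    and pole: "E z = 0" "\<And>j. j \<in> J \<Longrightarrow> F j z \<noteq> 0"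
  shows "p z = 0"
proof -
  define H where "H = (\<lambda>z. p z * (\<Prod>j\<in>J. F j z)
    + E z ^ k * ((\<Sum>j\<in>J. g j z * (\<Prod>i\<in>J-{j}. F i z)) + c * (\<Prod>j\<in>J. F j z)))"
  have "H z = 0"
  proof (rule entire_zero_on_reals[where f = H])
    show "H holomorphic_on UNIV"
      unfolding H_def by (intro holomorphic_intros hol) auto
    fix x :: real
    have "g j x * (\<Prod>i\<in>J-{j}. F i x) = g j x / F j x * (\<Prod>i\<in>J. F i x)" if "j \<in> J" for j
      using real_nz(2)[OF that] prod.remove[OF \<open>finite J\<close> that, of "\<lambda>i. F i x"] by simp
    then have "(\<Sum>j\<in>J. g j x * (\<Prod>i\<in>J-{j}. F i x)) = (\<Sum>j\<in>J. g j x / F j x) * (\<Prod>i\<in>J. F i x)"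
      by (simp add: sum_distrib_right)
    then have "H x = E x ^ k * (\<Prod>i\<in>J. F i x) * (p x / E x ^ k + (\<Sum>j\<in>J. g j x / F j x) + c)"
      using real_nz(1)[of x] by (simp add: H_def algebra_simps)
    then show "H x = 0" by (simp only: zero mult_zero_right)
  qed
  then have "p z * (\<Prod>j\<in>J. F j z) = 0"
    using pole(1) \<open>0 < k\<close> by (simp add: H_def zero_power)
  then show ?thesis using pole(2) \<open>finite J\<close> by auto
qed

text \<open>If \<open>\<rho>\<close> is rational with denominator \<open>S\<close>, then \<open>(1 + 2nS) \<rho>\<close> differs from \<open>\<rho>\<close> by an integer.\<close>

lemma odd_multiples_avoiding_Ints:
  fixes R :: "real set"
  assumes "finite R" "\<And>\<rho>. \<rho> \<in> R \<Longrightarrow> 0 < \<bar>\<rho>\<bar> \<and> \<bar>\<rho>\<bar> < 1"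
  shows "\<exists>S::nat. 0 < S \<and> (\<forall>\<rho>\<in>R. \<forall>n::nat. real (1 + 2 * n * S) * \<rho> \<notin> \<int>)"
proof -
  \<comment> \<open>\<open>s\<close> is a denominator for rational \<rho>; for irrational \<rho> any
    positive number serves.\<close>
  have "\<exists>s::nat. 0 < s \<and> (\<rho> \<in> \<rat> \<longrightarrow> real s * \<rho> \<in> \<int>)" for \<rho> :: real
  proof (cases "\<rho> \<in> \<rat>")
    case True
    then obtain a b :: int where "b > 0" "\<rho> = of_int a / of_int b" by (meson Rats_cases')
    then show ?thesis by (intro exI[of _ "nat b"]) simp
  qed (use zero_less_one in blast)
  then obtain s :: "real \<Rightarrow> nat"
    where s: "\<And>\<rho>. 0 < s \<rho>" "\<And>\<rho>. \<rho> \<in> \<rat> \<Longrightarrow> real (s \<rho>) * \<rho> \<in> \<int>" by metis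
  define S where "S = (\<Prod>\<rho>\<in>R. s \<rho>)"
  have "real (1 + 2 * n * S) * \<rho> \<notin> \<int>" if "\<rho> \<in> R" for \<rho> n
  proof
    assume *: "real (1 + 2 * n * S) * \<rho> \<in> \<int>"
    \<comment> \<open>An integral multiple forces \<rho> to be rational, so \<open>S\<close> is a
      multiple of its denominator; subtracting \<open>2 * n * S * \<rho>\<close> then leaves \<rho>
      itself an integer.\<close>
    then have "real (1 + 2 * n * S) * \<rho> / real (1 + 2 * n * S) \<in> \<rat>"
      using Ints_subset_Rats by (intro Rats_divide) auto
    then have "\<rho> \<in> \<rat>" by (simp del: of_nat_add of_nat_mult add: add_pos_nonneg)
    moreover have Seq: "S = s \<rho> * (\<Prod>\<rho>'\<in>R-{\<rho>}. s \<rho>')"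
      unfolding S_def by (rule prod.remove[OF assms(1) that])
    ultimately have "real (2 * n * (\<Prod>\<rho>'\<in>R-{\<rho>}. s \<rho>')) * (real (s \<rho>) * \<rho>) \<in> \<int>"
      using s(2) by (metis Ints_mult Ints_of_nat)
    also have "real (2 * n * (\<Prod>\<rho>'\<in>R-{\<rho>}. s \<rho>')) * (real (s \<rho>) * \<rho>) = real (2 * n * S) * \<rho>"
      using Seq by (simp add: ac_simps)
    finally have "real (1 + 2 * n * S) * \<rho> - real (2 * n * S) * \<rho> \<in> \<int>"
      using * by (rule Ints_diff[rotated])
    then have "\<rho> \<in> \<int>" by (simp add: algebra_simps)
    then show False using assms(2)[OF that] by (auto elim!: Ints_cases)
  qed
  moreover have "0 < S" unfolding S_def using s(1) by (simp add: prod_pos)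
  ultimately show ?thesis by blast
qed

text \<open>Locates the poles of the complex sigmoid; the integrality is what
  \<open>odd_multiples_avoiding_Ints\<close> contradicts.\<close>

lemma one_plus_exp_zeroD:
  fixes w :: complex
  assumes "1 + exp (- w) = 0"
  shows "Re w = 0" "Im w / pi \<in> \<int>"
proof -
  have e: "exp (- w) = -1" using assms by (simp add: add_eq_0_iff)
  then have "norm (exp (- w)) = 1" by simp
  then show "Re w = 0" by simp
  then have "sin (Im w) = 0" using arg_cong[OF e, of Im] by (simp add: Im_exp)
  then show "Im w / pi \<in> \<int>" by (auto simp: sin_zero_iff_int2)
qed

text \<open>The poles of unit \<open>i\<close> have order at most 3. Each round kills the leading
  numerator at the points \<open>Z n\<close>, which lowers the order by one, from 3 to 2 to 1 to 0.
  Maximality of the slope keeps all ratios \<open>\<alpha> j / \<alpha> i\<close> within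
  [-1, 1].\<close>

lemma sigmoid_ridge_dominant:
  fixes \<alpha> b A B C D e :: "'i \<Rightarrow> real" and c :: real
  assumes "finite I" "i \<in> I"
    and nz: "\<And>j. j \<in> I \<Longrightarrow> \<alpha> j \<noteq> 0"
    and distinct: "\<And>j. j \<in> I \<Longrightarrow> j \<noteq> i \<Longrightarrow>
      (\<alpha> j, b j) \<noteq> (\<alpha> i, b i) \<and> (\<alpha> j, b j) \<noteq> (- \<alpha> i, - b i)"
    and dom: "\<And>j. j \<in> I \<Longrightarrow> \<bar>\<alpha> j\<bar> \<le> \<bar>\<alpha> i\<bar>"
    and zero: "\<And>z. c + (\<Sum>j\<in>I. (A j * z\<^sup>2 + C j) * deriv (deriv sigmoid) (b j + \<alpha> j * z)
      + (B j * z + D j) * deriv sigmoid (b j + \<alpha> j * z) + e j * sigmoid (b j + \<alpha> j * z)) = 0"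
  shows "A i = 0 \<and> B i = 0 \<and> C i = 0 \<and> D i = 0 \<and> e i = 0"
proof -
  define R where "R = (\<lambda>j. \<alpha> j / \<alpha> i) ` {j\<in>I. \<bar>\<alpha> j\<bar> < \<bar>\<alpha> i\<bar>}"
  have "finite R" "\<And>\<rho>. \<rho> \<in> R \<Longrightarrow> 0 < \<bar>\<rho>\<bar> \<and> \<bar>\<rho>\<bar> < 1"
    using \<open>finite I\<close> nz by (auto simp: R_def)
  from odd_multiples_avoiding_Ints[OF this] obtain S :: nat
    where S: "0 < S" "\<And>\<rho> n. \<rho> \<in> R \<Longrightarrow> real (1 + 2 * n * S) * \<rho> \<notin> \<int>" by blast
  define w where "w = (\<lambda>j z. of_real (b j) + of_real (\<alpha> j) * z :: complex)"
  define X where "X = (\<lambda>j z. exp (- w j z))"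
  define E where "E = (\<lambda>j z. 1 + X j z)"
  have E_of_real: "E j (of_real x) = of_real (1 + exp (- (b j + \<alpha> j * x)))" for j x
    by (simp add: E_def X_def w_def flip: exp_of_real)
  have E_nz: "E j (of_real x) \<noteq> 0" for j x
    unfolding E_of_real of_real_eq_0_iff by (smt (verit) exp_gt_zero)
  have hol: "X j holomorphic_on UNIV" "E j holomorphic_on UNIV" for j
    unfolding X_def E_def w_def by (intro holomorphic_intros)+
  \<comment> \<open>\<open>Z n\<close> solves \<open>w i z = \<i> * pi * (1 + 2 * n * S)\<close>: a
    pole of unit \<open>i\<close> whose odd multiple is chosen to avoid the poles of units with
    smaller slopes.\<close>
  define Z where "Z = (\<lambda>n::nat. Complex (- b i / \<alpha> i) (pi * real (1 + 2 * n * S) / \<alpha> i))"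
  have \<alpha>i: "\<alpha> i \<noteq> 0" using nz \<open>i \<in> I\<close> by blast
  have X_pole: "X i (Z n) = -1" for n
  proof -
    have "- w i (Z n) = \<i> * of_real (pi * of_int (- 1 - 2 * int (n * S)))"
      using \<alpha>i by (simp add: complex_eq_iff w_def Z_def) (simp add: algebra_simps)
    then have "X i (Z n) = cis (pi * of_int (- 1 - 2 * int (n * S)))"
      by (simp only: X_def cis_conv_exp)
    also have "\<dots> = -1"
      unfolding complex_eq_iff cis.sel cos_npi_int sin_npi_int by simp
    finally show ?thesis .
  qed
  \<comment> \<open>The choice of \<open>S\<close> excludes ratios of modulus below 1. For ratio 1
    or -1, the real part forces the bias to agree with the same sign, against
    \<open>distinct\<close>.\<close>
  have unshared: "E j (Z n) \<noteq> 0" if j: "j \<in> I - {i}" for j n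
  proof
    assume "E j (Z n) = 0"
    then have re: "Re (w j (Z n)) = 0" and im: "Im (w j (Z n)) / pi \<in> \<int>"
      using one_plus_exp_zeroD unfolding E_def X_def by blast+
    have re': "b j * \<alpha> i = \<alpha> j * b i" using re \<alpha>i by (simp add: w_def Z_def field_simps)
    have "Im (w j (Z n)) / pi = real (1 + 2 * n * S) * (\<alpha> j / \<alpha> i)"
      by (simp add: w_def Z_def)
    then have "\<alpha> j / \<alpha> i \<notin> R" using S(2) im by metis
    then have "\<bar>\<alpha> j\<bar> = \<bar>\<alpha> i\<bar>" using j dom[of j] by (force simp: R_def)
    then consider "\<alpha> j = \<alpha> i" | "\<alpha> j = - \<alpha> i" by (auto simp: abs_eq_iff)
    then show False
    proof cases
      case 1
      with re' \<alpha>i have "b j = b i" by simp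
      with 1 distinct[of j] j show False by simp
    next
      case 2
      with re' have "(b j + b i) * \<alpha> i = 0" by (simp add: algebra_simps)
      with \<alpha>i have "b j = - b i" by simp
      with 2 distinct[of j] j show False by simp
    qed
  qed
  \<comment> \<open>Numerator over the common denominator \<open>E j ^ 3\<close>, from \<phi>'' =
    X(X - 1)/E^3, \<phi>' = X/E^2 and \<phi> = 1/E.\<close>
  define h where "h = (\<lambda>j z. (of_real (A j) * z\<^sup>2 + of_real (C j)) * X j z * (X j z - 1)
     + (of_real (B j) * z + of_real (D j)) * X j z * E j z + of_real (e j) * E j z ^ 2)"
  have hol_h: "h j holomorphic_on UNIV" for j
    unfolding h_def by (intro holomorphic_intros hol)
  have h_real: "h j (of_real x) / E j (of_real x) ^ 3 =
     of_real ((A j * x\<^sup>2 + C j) * deriv (deriv sigmoid) (b j + \<alpha> j * x)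
      + (B j * x + D j) * deriv sigmoid (b j + \<alpha> j * x) + e j * sigmoid (b j + \<alpha> j * x))" for j x
  proof -
    define r where "r = exp (- (b j + \<alpha> j * x))"
    have X: "X j (of_real x) = of_real r"
      by (simp add: r_def X_def w_def flip: exp_of_real)
    have "r > 0" by (simp add: r_def)
    have "h j (of_real x) / E j (of_real x) ^ 3 = of_real (((A j * x\<^sup>2 + C j) * r * (r - 1)
       + (B j * x + D j) * r * (1 + r) + e j * (1 + r) ^ 2) / (1 + r) ^ 3)"
      by (simp add: h_def E_def X)
    also have "((A j * x\<^sup>2 + C j) * r * (r - 1)
       + (B j * x + D j) * r * (1 + r) + e j * (1 + r) ^ 2) / (1 + r) ^ 3
       = (A j * x\<^sup>2 + C j) * (r * (r - 1) / (1 + r) ^ 3)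
       + (B j * x + D j) * (r / (1 + r) ^ 2) + e j * (1 / (1 + r))"
      using \<open>r > 0\<close> by (simp add: add_divide_distrib power2_eq_square power3_eq_cube)
    finally show ?thesis
      unfolding deriv_deriv_sigmoid deriv_sigmoid sigmoid_def r_def .
  qed
  have sum0: "h i (of_real x) / E i (of_real x) ^ 3
     + (\<Sum>j\<in>I-{i}. h j (of_real x) / E j (of_real x) ^ 3) + of_real c = 0" for x
    unfolding h_real of_real_sum[symmetric] of_real_add[symmetric] of_real_eq_0_iff
    using zero[of x] unfolding sum.remove[OF \<open>finite I\<close> \<open>i \<in> I\<close>] by linarith
  \<comment> \<open>Here \<open>p\<close> is what remains of \<open>h i\<close> after cancelling
    powers of \<open>E i\<close>; it is used with \<open>k\<close> = 3, 2 and 1.\<close>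
  have key: "p (Z n) = 0"
    if "0 < k" "p holomorphic_on UNIV"
      and "\<And>x. h i (of_real x) / E i (of_real x) ^ 3 = p (of_real x) / E i (of_real x) ^ k" for p k n
  proof (rule numerator_zero_at_unshared_pole[where J = "I-{i}" and p = p and E = "E i" and k = k
        and g = h and F = "\<lambda>j z. E j z ^ 3" and c = "of_real c"])
    show "E i (Z n) = 0" by (simp add: E_def X_pole)
    show "p (of_real x) / E i (of_real x) ^ k
      + (\<Sum>j\<in>I - {i}. h j (of_real x) / E j (of_real x) ^ 3) + of_real c = 0" for x
      using sum0 that(3) by simp
  qed (use \<open>finite I\<close> that hol_h hol E_nz unshared in \<open>auto intro!: holomorphic_intros\<close>)
  have ImZ: "Im (Z n) \<noteq> 0" for n using \<alpha>i by (simp add: Z_def add_nonneg_eq_0_iff)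
  have AC: "of_real (A i) * (Z n)\<^sup>2 + of_real (C i) = 0" for n
  proof -
    have "h i (Z n) = 0" using key[of 3 "h i" n] hol_h by simp
    \<comment> \<open>At the pole \<open>X\<close> = -1 and \<open>E\<close> = 0, so X(X - 1) = 2
      and only the \<phi>'' term survives.\<close>
    then have "2 * (of_real (A i) * (Z n)\<^sup>2 + of_real (C i)) = 0"
      by (simp add: h_def X_pole E_def algebra_simps)
    then show ?thesis unfolding mult_eq_0_iff by simp
  qed
  then have "of_real (A i) * ((Z 0)\<^sup>2 - (Z 1)\<^sup>2) = 0"
    by (metis (no_types, lifting) add_right_cancel right_diff_distrib' right_minus_eq)
  \<comment> \<open>Two poles separate \<open>A i\<close> from \<open>C i\<close>: since
    \<open>S\<close> is positive, the imaginary parts of \<open>Z 0\<close> and \<open>Z 1\<close>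
    differ in modulus.\<close>
  moreover have "(Z 0)\<^sup>2 \<noteq> (Z 1)\<^sup>2"
  proof
    assume "(Z 0)\<^sup>2 = (Z 1)\<^sup>2"
    then have "Z 0 = Z 1 \<or> Z 0 = - Z 1" by (simp only: power2_eq_iff)
    then have "Im (Z 0) = Im (Z 1) \<or> Im (Z 0) = - Im (Z 1)" by auto
    moreover have Im_Z: "Im (Z 0) = pi / \<alpha> i * 1" "Im (Z 1) = pi / \<alpha> i * real (1 + 2 * S)"
      by (simp_all add: Z_def)
    ultimately have "pi / \<alpha> i * 1 = pi / \<alpha> i * real (1 + 2 * S)
      \<or> pi / \<alpha> i * 1 = pi / \<alpha> i * (- real (1 + 2 * S))"
      by (simp only: Im_Z mult_minus_right)
    then show False unfolding mult_cancel_left using S(1) \<alpha>i by auto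
  qed
  ultimately have "A i = 0" by simp
  with AC have "C i = 0" by simp
  have BD: "of_real (B i) * Z n + of_real (D i) = 0" for n
  proof -
    \<comment> \<open>With \<open>A i\<close> and \<open>C i\<close> gone, \<open>E i\<close>
      divides \<open>h i\<close>, and \<open>p\<close> is the cofactor; its value at
      \<open>Z n\<close> is -(B Z + D).\<close>
    define p where "p = (\<lambda>z. (of_real (B i) * z + of_real (D i)) * X i z + of_real (e i) * E i z)"
    have "h i z = p z * E i z" for z
      by (simp add: h_def p_def \<open>A i = 0\<close> \<open>C i = 0\<close> algebra_simps power2_eq_square)
    then have "h i (of_real x) / E i (of_real x) ^ 3 = p (of_real x) / E i (of_real x) ^ 2" for x
      using E_nz by (simp add: power2_eq_square power3_eq_cube)
    moreover have "p holomorphic_on UNIV" unfolding p_def by (intro holomorphic_intros hol)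
    ultimately have "p (Z n) = 0" using key[of 2 p n] by simp
    then show ?thesis by (simp add: p_def X_pole E_def neg_eq_iff_add_eq_0)
  qed
  \<comment> \<open>All coefficients are real, so the imaginary part isolates
    \<open>B i\<close>.\<close>
  have "B i = 0" using arg_cong[OF BD[of 0], of Im] ImZ[of 0] by simp
  with BD have "D i = 0" by simp
  have "h i z = of_real (e i) * E i z ^ 2" for z
    by (simp add: h_def \<open>A i = 0\<close> \<open>B i = 0\<close> \<open>C i = 0\<close> \<open>D i = 0\<close>)
  then have "h i (of_real x) / E i (of_real x) ^ 3 = of_real (e i) / E i (of_real x) ^ 1" for x
    using E_nz by (simp add: power2_eq_square power3_eq_cube)
  then have "of_real (e i) = (0::complex)" using key[of 1 "\<lambda>z. of_real (e i)"] by simp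
  then show ?thesis using \<open>A i = 0\<close> \<open>C i = 0\<close> \<open>B i = 0\<close> \<open>D i = 0\<close> by simp
qed

text \<open>Units are removed one at a time, always one of maximal absolute slope; when none is
  left, the relation reads \<open>c = 0\<close>.\<close>

lemma sigmoid_ridge_independent:
  fixes \<alpha> b A B C D e :: "'i \<Rightarrow> real" and c :: real
  assumes "finite I"
    and "\<And>j. j \<in> I \<Longrightarrow> \<alpha> j \<noteq> 0"
    and "\<And>i j. i \<in> I \<Longrightarrow> j \<in> I \<Longrightarrow> j \<noteq> i \<Longrightarrow>
      (\<alpha> j, b j) \<noteq> (\<alpha> i, b i) \<and> (\<alpha> j, b j) \<noteq> (- \<alpha> i, - b i)"
    and "\<And>z. c + (\<Sum>j\<in>I. (A j * z\<^sup>2 + C j) * deriv (deriv sigmoid) (b j + \<alpha> j * z)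
      + (B j * z + D j) * deriv sigmoid (b j + \<alpha> j * z) + e j * sigmoid (b j + \<alpha> j * z)) = 0"
  shows "c = 0 \<and> (\<forall>i\<in>I. A i = 0 \<and> B i = 0 \<and> C i = 0 \<and> D i = 0 \<and> e i = 0)"
  using assms
proof (induction "card I" arbitrary: I)
  case 0
  then show ?case by simp
next
  case (Suc n)
  then have "Max ((\<lambda>j. \<bar>\<alpha> j\<bar>) ` I) \<in> (\<lambda>j. \<bar>\<alpha> j\<bar>) ` I" by (intro Max_in) auto
  then obtain i where i: "i \<in> I" "\<bar>\<alpha> i\<bar> = Max ((\<lambda>j. \<bar>\<alpha> j\<bar>) ` I)" by auto
  have i0: "A i = 0 \<and> B i = 0 \<and> C i = 0 \<and> D i = 0 \<and> e i = 0"
  proof (rule sigmoid_ridge_dominant[OF Suc.prems(1) i(1) Suc.prems(2) _ _ Suc.prems(4)])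
    show "\<bar>\<alpha> j\<bar> \<le> \<bar>\<alpha> i\<bar>" if "j \<in> I" for j
      unfolding i(2) using that \<open>finite I\<close> by simp
  qed (use Suc.prems(3) i(1) in auto)
  have "c = 0 \<and> (\<forall>i\<in>I-{i}. A i = 0 \<and> B i = 0 \<and> C i = 0 \<and> D i = 0 \<and> e i = 0)"
  proof (rule Suc.hyps)
    show "n = card (I - {i})" using Suc.hyps(2) i(1) Suc.prems(1) by simp
    show "c + (\<Sum>j\<in>I - {i}. (A j * z\<^sup>2 + C j) * deriv (deriv sigmoid) (b j + \<alpha> j * z)
      + (B j * z + D j) * deriv sigmoid (b j + \<alpha> j * z) + e j * sigmoid (b j + \<alpha> j * z)) = 0" for z
      using Suc.prems(4)[of z] unfolding sum.remove[OF Suc.prems(1) i(1)] by (simp add: i0)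
  qed (use Suc.prems in auto)
  with i0 show ?case by blast
qed

section \<open>Minimal networks\<close>

text \<open>Reindexing allows a unit to be dropped from any position, although \<open>mlp\<close>
  numbers its units consecutively.\<close>

lemma finite_sum_mlp_function:
  assumes "finite I"
  shows "mlp_function \<phi> (card I) (\<lambda>x. \<beta> + (\<Sum>i\<in>I. a i * \<phi> (w i \<bullet> ext x)))"
proof -
  obtain h where h: "bij_betw h {1..card I} I"
    using ex_bij_betw_nat_finite_1[OF assms] by blast
  have "(\<lambda>x. \<beta> + (\<Sum>i\<in>I. a i * \<phi> (w i \<bullet> ext x))) = mlp \<phi> (card I) \<beta> (a \<circ> h) (w \<circ> h)"
    by (simp add: fun_eq_iff mlp_def sum.reindex_bij_betw[OF h, symmetric])
  then show ?thesis unfolding mlp_function_def by blast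
qed

lemma minimal_mlp_not_fewer_units:
  assumes "minimal_mlp_function \<phi> k (mlp \<phi> k \<beta> a w)" "i \<in> {1..k}"
  shows "mlp \<phi> k \<beta> a w \<noteq> (\<lambda>x. \<beta>' + (\<Sum>j\<in>{1..k} - {i}. a' j * \<phi> (w j \<bullet> ext x)))"
proof
  assume "mlp \<phi> k \<beta> a w = (\<lambda>x. \<beta>' + (\<Sum>j\<in>{1..k} - {i}. a' j * \<phi> (w j \<bullet> ext x)))"
  then have "mlp_function \<phi> (card ({1..k} - {i})) (mlp \<phi> k \<beta> a w)"
    by (simp add: finite_sum_mlp_function)
  moreover have "card ({1..k} - {i}) < k" using assms(2) by auto
  ultimately show False using assms(1) unfolding minimal_mlp_function_def by blast
qed

text \<open>A unit without input dependence could be absorbed into the bias \<beta>.\<close>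

lemma minimal_mlp_weight_nonconstant:
  assumes "minimal_mlp_function \<phi> k (mlp \<phi> k \<beta> a w)" "i \<in> {1..k}"
  shows "snd (w i) \<noteq> 0"
proof
  assume "snd (w i) = 0"
  then have "mlp \<phi> k \<beta> a w
    = (\<lambda>x. \<beta> + a i * \<phi> (fst (w i)) + (\<Sum>j\<in>{1..k} - {i}. a j * \<phi> (w j \<bullet> ext x)))"
    using assms(2) by (auto simp: fun_eq_iff mlp_def sum.remove[of _ i] ext_def inner_prod_def)
  then show False using minimal_mlp_not_fewer_units[OF assms] by blast
qed

text \<open>Unit \<open>i\<close> could be merged into unit \<open>j\<close>, adding
  \<open>a i * s\<close> to its coefficient and \<open>a i * r\<close> to the bias.\<close>

lemma minimal_mlp_weights_distinct:
  assumes "minimal_mlp_function \<phi> k (mlp \<phi> k \<beta> a w)" "i \<in> {1..k}" "j \<in> {1..k}" "i \<noteq> j"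
    and affine: "\<And>x. \<phi> (w i \<bullet> ext x) = r + s * \<phi> (w j \<bullet> ext x)"
  shows False
proof -
  define a' where "a' = a(j := a j + a i * s)"
  have "(\<Sum>l\<in>{1..k}. a l * \<phi> (w l \<bullet> ext x))
    = a i * r + (\<Sum>l\<in>{1..k} - {i}. a' l * \<phi> (w l \<bullet> ext x))" for x
  proof -
    have j: "j \<in> {1..k} - {i}" using assms by auto
    have "(\<Sum>l\<in>{1..k} - {i}. a' l * \<phi> (w l \<bullet> ext x))
      = (a j + a i * s) * \<phi> (w j \<bullet> ext x) + (\<Sum>l\<in>{1..k} - {i} - {j}. a l * \<phi> (w l \<bullet> ext x))"
      using j by (simp add: sum.remove[of _ j] a'_def)
    moreover have "(\<Sum>l\<in>{1..k}. a l * \<phi> (w l \<bullet> ext x)) = a i * (r + s * \<phi> (w j \<bullet> ext x))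
      + (a j * \<phi> (w j \<bullet> ext x) + (\<Sum>l\<in>{1..k} - {i} - {j}. a l * \<phi> (w l \<bullet> ext x)))"
      using j assms(2) affine[of x] sum.remove[of "{1..k}" i "\<lambda>l. a l * \<phi> (w l \<bullet> ext x)"]
        sum.remove[of "{1..k} - {i}" j "\<lambda>l. a l * \<phi> (w l \<bullet> ext x)"] by simp
    ultimately show ?thesis by (simp add: algebra_simps)
  qed
  then have "mlp \<phi> k \<beta> a w = (\<lambda>x. (\<beta> + a i * r) + (\<Sum>l\<in>{1..k} - {i}. a' l * \<phi> (w l \<bullet> ext x)))"
    by (simp add: fun_eq_iff mlp_def)
  then show False using minimal_mlp_not_fewer_units[OF assms(1,2)] by blast
qed

section \<open>Almost everywhere vanishing and coefficients of forms\<close>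

text \<open>The zero set is closed, and a closed set of full Lebesgue measure is the whole
  space.\<close>

lemma continuous_AE_lebesgue_zero:
  fixes f :: "'a::euclidean_space \<Rightarrow> real"
  assumes "continuous_on UNIV f" "AE x in lebesgue. f x = 0"
  shows "f x = 0"
proof -
  have "closed {x. f x = 0}" by (intro closed_Collect_eq assms(1) continuous_on_const)
  from mem_closed_if_AE_lebesgue[OF this, of x] assms(2) show ?thesis by simp
qed

lemma AE_off_hyperplanes:
  fixes V :: "'a::euclidean_space set"
  assumes "finite V" "0 \<notin> V"
  shows "AE u in lebesgue. \<forall>v\<in>V. v \<bullet> u \<noteq> 0"
proof (rule AE_finite_allI[OF assms(1)])
  fix v assume "v \<in> V"
  then have "negligible {u. v \<bullet> u = 0}" using assms(2) by (intro negligible_hyperplane) auto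
  then have "{u. v \<bullet> u = 0} \<in> null_sets lebesgue" by (simp add: negligible_iff_null_sets)
  from AE_not_in[OF this] show "AE u in lebesgue. v \<bullet> u \<noteq> 0" by simp
qed

text \<open>Polarization: unit vectors give the diagonal coefficients, then sums of two unit vectors
  give the mixed ones.\<close>

lemma quadratic_form_coeffs_zero:
  fixes c :: "'d::{finite,linorder} \<Rightarrow> 'd \<Rightarrow> real"
  assumes "\<And>u :: real ^ 'd::{finite,linorder}. (\<Sum>(l, m)\<in>{(l, m). l \<le> m}. c l m * (u $ l * u $ m)) = 0" "l \<le> m"
  shows "c l m = 0"
proof -
  have diag: "c l l = 0" for l
  proof -
    have "(\<Sum>(i, j)\<in>{(i, j). i \<le> j}. c i j * (axis l 1 $ i * axis l 1 $ j))
      = (\<Sum>p\<in>{(i, j). i \<le> j}. if p = (l, l) then c l l else 0)"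
      by (intro sum.cong) (auto simp: axis_def split: if_splits)
    then show ?thesis using assms(1)[of "axis l 1"] by (simp add: sum.delta)
  qed
  show ?thesis
  proof (cases "l = m")
    case False
    have "(\<Sum>(i, j)\<in>{(i, j). i \<le> j}. c i j * ((axis l 1 + axis m 1) $ i * (axis l 1 + axis m 1) $ j))
      = (\<Sum>p\<in>{(i, j). i \<le> j}. if p = (l, m) then c l m else 0)"
      using False assms(2) diag by (intro sum.cong) (auto simp: axis_def split: if_splits)
    then show ?thesis using assms(1)[of "axis l 1 + axis m 1"] assms(2) by (simp add: sum.delta)
  qed (use diag in simp)
qed

lemma linear_form_coeffs_zero:
  fixes c :: "'d::finite \<Rightarrow> real"
  assumes "\<And>u :: real ^ 'd::finite. (\<Sum>m\<in>UNIV. c m * u $ m) = 0"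
  shows "c m = 0"
proof -
  have "(\<Sum>i\<in>UNIV. c i * axis m 1 $ i) = (\<Sum>i\<in>UNIV. if i = m then c m else 0)"
    by (intro sum.cong) (auto simp: axis_def)
  then show ?thesis using assms[of "axis m 1"] by simp
qed

section \<open>The score functions\<close>

lemma score_indices_images:
  "score_indices k = {Const} \<union> (\<lambda>(i, l, m). Quad_D2 i l m) ` ({1..k} \<times> {(l, m). l \<le> m})
     \<union> D2 ` {1..k} \<union> (\<lambda>(i, m). Lin_D1 i m) ` ({1..k} \<times> UNIV) \<union> D1 ` {1..k} \<union> D0 ` {1..k}"
  unfolding score_indices_def image_def by auto

lemma finite_score_indices:
  "finite (score_indices k :: 'd::{finite,linorder} score_index set)"
  unfolding score_indices_images by simp

text \<open>Grouping by unit gives the shape that \<open>sigmoid_ridge_independent\<close> needs on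
  each line.\<close>

lemma sum_score_fun:
  fixes c :: "'d::{finite,linorder} score_index \<Rightarrow> real"
  shows "(\<Sum>j\<in>score_indices k. c j * score_fun \<phi> w j x) = c Const + (\<Sum>i=1..k.
      ((\<Sum>(l, m)\<in>{(l, m). l \<le> m}. c (Quad_D2 i l m) * (x $ l * x $ m)) + c (D2 i))
        * deriv (deriv \<phi>) (w i \<bullet> ext x)
      + ((\<Sum>m\<in>UNIV. c (Lin_D1 i m) * x $ m) + c (D1 i)) * deriv \<phi> (w i \<bullet> ext x)
      + c (D0 i) * \<phi> (w i \<bullet> ext x))"
proof -
  have inj: "inj_on (\<lambda>(i, l, m). Quad_D2 i l m) S" "inj_on (\<lambda>(i, m). Lin_D1 i m) T"
    "inj_on D2 U" "inj_on D1 U" "inj_on D0 U"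
    for S :: "(nat \<times> 'd \<times> 'd) set" and T :: "(nat \<times> 'd) set" and U
    by (auto simp: inj_on_def)
  have Quad: "(\<Sum>j\<in>(\<lambda>(i, l, m). Quad_D2 i l m) ` ({1..k} \<times> {(l, m). l \<le> m}). c j * score_fun \<phi> w j x)
    = (\<Sum>i=1..k. (\<Sum>(l, m)\<in>{(l, m). l \<le> m}. c (Quad_D2 i l m) * (x $ l * x $ m))
        * deriv (deriv \<phi>) (w i \<bullet> ext x))"
    unfolding sum.reindex[OF inj(1)]
    by (simp add: sum.cartesian_product sum_distrib_right case_prod_unfold mult.assoc)
  have Lin: "(\<Sum>j\<in>(\<lambda>(i, m). Lin_D1 i m) ` ({1..k} \<times> UNIV). c j * score_fun \<phi> w j x)
    = (\<Sum>i=1..k. (\<Sum>m\<in>UNIV. c (Lin_D1 i m) * x $ m) * deriv \<phi> (w i \<bullet> ext x))"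
    unfolding sum.reindex[OF inj(2)]
    by (simp add: sum.cartesian_product sum_distrib_right case_prod_unfold mult.assoc)
  show ?thesis
    unfolding score_indices_images
    apply (subst sum.union_disjoint; (simp; fail)?, (force; fail)?)+
    apply (simp only: Quad Lin)
    apply (simp add: sum.reindex inj sum.distrib distrib_right)
    done
qed

section \<open>Square integrability from the sixth moment\<close>

lemma continuous_score_fun_sigmoid:
  "continuous_on S (score_fun sigmoid w j)"
proof -
  have w: "continuous_on S (\<lambda>x. w i \<bullet> ext x)" for i
    unfolding ext_def by (intro continuous_intros)
  note comp = continuous_on_compose2[OF continuous_sigmoid[of UNIV] w]
    continuous_on_compose2[OF continuous_deriv_sigmoid[of UNIV] w]
    continuous_on_compose2[OF continuous_deriv_deriv_sigmoid[of UNIV] w]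
  show ?thesis by (cases j) (auto intro!: continuous_intros comp)
qed

text \<open>The sigmoid and its two derivatives are bounded by 1, so growth is at most quadratic;
  the exponent 3 is chosen so that squares are controlled by the sixth moment.\<close>

lemma abs_score_fun_sigmoid_le: "\<bar>score_fun sigmoid w j x\<bar> \<le> 1 + norm x ^ 3"
proof -
  define n where "n = norm x"
  have n: "n \<ge> 0" by (simp add: n_def)
  then have n3: "1 \<le> 1 + n ^ 3" by simp
  have n1: "n \<le> 1 + n ^ 3" and n2: "n * n \<le> 1 + n ^ 3"
  proof -
    have "n \<le> 1 + n ^ 3 \<and> n * n \<le> 1 + n ^ 3"
    proof (cases "n \<le> 1")
      case True
      then have "n * n \<le> 1" using n mult_le_one by blast
      with True n show ?thesis by (smt (verit) zero_le_power)
    next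
      case False
      then have "n ^ 1 \<le> n ^ 3" "n ^ 2 \<le> n ^ 3" by (intro power_increasing; simp)+
      then show ?thesis by (simp add: power2_eq_square)
    qed
    then show "n \<le> 1 + n ^ 3" "n * n \<le> 1 + n ^ 3" by auto
  qed
  have comp: "\<bar>x $ l\<bar> \<le> n" for l by (simp add: n_def component_le_norm_cart)
  have lin: "\<bar>x $ m * r\<bar> \<le> 1 + n ^ 3" if "\<bar>r\<bar> \<le> 1" for m r
    using mult_mono[OF comp[of m] that] n n1 by (simp add: abs_mult)
  have quad: "\<bar>x $ l * x $ m * r\<bar> \<le> 1 + n ^ 3" if "\<bar>r\<bar> \<le> 1" for l m r
    using mult_mono[OF mult_mono[OF comp[of l] comp[of m]] that] n n2 by (simp add: abs_mult)
  show ?thesis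
    unfolding n_def[symmetric] using n3
    by (cases j) (auto intro: lin quad abs_deriv_sigmoid_le_1 abs_deriv_deriv_sigmoid_le_1
        order_trans[OF abs_deriv_sigmoid_le_1] order_trans[OF abs_deriv_deriv_sigmoid_le_1]
        order_trans[OF abs_sigmoid_le_1])
qed

lemma L2_density_lebesgue_cubic_growth:
  fixes f :: "'a::euclidean_space \<Rightarrow> real" and q :: "'a \<Rightarrow> real"
  assumes q: "q \<in> borel_measurable lebesgue" "\<And>x. q x \<ge> 0" "prob_space (density lebesgue q)"
    and moment: "integrable lebesgue (\<lambda>x. norm x ^ 6 * q x)"
    and f: "continuous_on UNIV f" "\<And>x. \<bar>f x\<bar> \<le> 1 + norm x ^ 3"
  shows "f \<in> L2 (density lebesgue q)"
proof -
  interpret prob_space "density lebesgue q" by (rule q(3))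
  have meas: "g \<in> borel_measurable lebesgue" if "continuous_on UNIV g" for g :: "'a \<Rightarrow> real"
    by (intro measurable_completion) (simp add: borel_measurable_continuous_onI that)
  have "integrable (density lebesgue q) (\<lambda>x. norm x ^ 6)"
    using moment q(1,2)
    by (subst integrable_density) (auto intro!: meas continuous_intros simp: mult.commute)
  then have "integrable (density lebesgue q) (\<lambda>x. 2 + 2 * norm x ^ 6)"
    by (intro Bochner_Integration.integrable_add integrable_mult_right integrable_const)
  moreover have f_meas: "f \<in> borel_measurable (density lebesgue q)" using meas[OF f(1)] by simp
  moreover have "(f x)\<^sup>2 \<le> 2 + 2 * norm x ^ 6" for x
  proof -
    have "(f x)\<^sup>2 \<le> (1 + norm x ^ 3)\<^sup>2" using f(2)[of x] by (simp add: abs_le_square_iff[symmetric])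
    also have "\<dots> \<le> 2 + 2 * norm x ^ 6"
      using zero_le_power2[of "1 - norm x ^ 3"]
      by (simp add: power2_diff power2_sum flip: power_mult)
    finally show ?thesis .
  qed
  ultimately have "integrable (density lebesgue q) (\<lambda>x. (f x)\<^sup>2)"
    using Bochner_Integration.integrable_bound[of "density lebesgue q" "\<lambda>x. 2 + 2 * norm x ^ 6" "\<lambda>x. (f x)\<^sup>2"]
    by (simp add: AE_I2 borel_measurable_power)
  with f_meas show ?thesis by (simp add: L2_def)
qed

section \<open>From lines through the origin to all coefficients\<close>

lemma sigmoid_score_combination_trivial:
  fixes w :: "nat \<Rightarrow> real \<times> (real ^ 'd::{finite,linorder})"
    and c :: "'d score_index \<Rightarrow> real"
  assumes nz: "\<And>i. i \<in> {1..k} \<Longrightarrow> snd (w i) \<noteq> 0"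
    and distinct: "\<And>i j. i \<in> {1..k} \<Longrightarrow> j \<in> {1..k} \<Longrightarrow> i \<noteq> j \<Longrightarrow> w i \<noteq> w j \<and> w i \<noteq> - w j"
    and zero: "\<And>x. (\<Sum>j\<in>score_indices k. c j * score_fun sigmoid w j x) = 0"
    and "j \<in> score_indices k"
  shows "c j = 0"
proof -
  \<comment> \<open>Normals of the hyperplanes to avoid: off them no slope vanishes and slopes
    coincide up to sign only if the directions do. In that case, where the vector is 0 and hence
    removed, the biases tell the units apart.\<close>
  define V where "V = (\<lambda>i. snd (w i)) ` {1..k} \<union> (\<lambda>(i, j). snd (w i) - snd (w j)) ` ({1..k} \<times> {1..k})
     \<union> (\<lambda>(i, j). snd (w i) + snd (w j)) ` ({1..k} \<times> {1..k}) - {0}"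
  define Q where "Q = (\<lambda>i (u :: real ^ 'd::{finite,linorder}). \<Sum>(l, m)\<in>{(l, m). l \<le> m}. c (Quad_D2 i l m) * (u $ l * u $ m))"
  define L where "L = (\<lambda>i (u :: real ^ 'd::{finite,linorder}). \<Sum>m\<in>UNIV. c (Lin_D1 i m) * u $ m)"
  have QL: "(\<Sum>(l, m)\<in>{(l, m). l \<le> m}. c (Quad_D2 i l m) * (u $ l * u $ m)) = Q i u"
    "(\<Sum>m\<in>UNIV. c (Lin_D1 i m) * u $ m) = L i u" for i u
    by (simp_all add: Q_def L_def)
  have generic: "c Const = 0 \<and> (\<forall>i\<in>{1..k}. Q i u = 0 \<and> L i u = 0 \<and> c (D2 i) = 0 \<and> c (D1 i) = 0 \<and> c (D0 i) = 0)"
    if u: "\<forall>v\<in>V. v \<bullet> u \<noteq> 0" for u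
  proof (rule sigmoid_ridge_independent[where \<alpha> = "\<lambda>i. snd (w i) \<bullet> u" and b = "\<lambda>i. fst (w i)"])
    show "snd (w i) \<bullet> u \<noteq> 0" if "i \<in> {1..k}" for i
      using u nz that by (auto simp: V_def)
    show "(snd (w j) \<bullet> u, fst (w j)) \<noteq> (snd (w i) \<bullet> u, fst (w i))
        \<and> (snd (w j) \<bullet> u, fst (w j)) \<noteq> (- (snd (w i) \<bullet> u), - fst (w i))"
      if ij: "i \<in> {1..k}" "j \<in> {1..k}" "j \<noteq> i" for i j
    proof -
      have "snd (w j) - snd (w i) \<in> insert 0 V" "snd (w j) + snd (w i) \<in> insert 0 V"
        using ij by (auto simp: V_def)
      moreover have "v = 0" if "v \<in> insert 0 V" "v \<bullet> u = 0" for v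
        using u that by auto
      ultimately have "snd (w j) \<bullet> u = snd (w i) \<bullet> u \<Longrightarrow> snd (w j) - snd (w i) = 0"
        "snd (w j) \<bullet> u = - (snd (w i) \<bullet> u) \<Longrightarrow> snd (w j) + snd (w i) = 0"
        by (simp_all only: inner_diff_left inner_add_left)
      then show ?thesis using distinct[OF ij(2,1,3)] by (auto simp: prod_eq_iff eq_neg_iff_add_eq_0)
    qed
    fix z
    have "w i \<bullet> ext (z *\<^sub>R u) = fst (w i) + snd (w i) \<bullet> u * z" for i
      by (simp add: ext_def inner_prod_def)
    \<comment> \<open>Homogeneity of degrees 2 and 1 supplies the coefficients of
      \<open>z\<^sup>2\<close> and \<open>z\<close>.\<close>
    moreover have "Q i (z *\<^sub>R u) = Q i u * z\<^sup>2" "L i (z *\<^sub>R u) = L i u * z" for i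
      by (simp_all add: Q_def L_def sum_distrib_left case_prod_unfold power2_eq_square ac_simps)
    ultimately show "c Const + (\<Sum>i\<in>{1..k}.
       (Q i u * z\<^sup>2 + c (D2 i)) * deriv (deriv sigmoid) (fst (w i) + snd (w i) \<bullet> u * z)
       + (L i u * z + c (D1 i)) * deriv sigmoid (fst (w i) + snd (w i) \<bullet> u * z)
       + c (D0 i) * sigmoid (fst (w i) + snd (w i) \<bullet> u * z)) = 0"
      using zero[of "z *\<^sub>R u"] unfolding sum_score_fun QL by simp
  qed simp
  have AE_V: "AE u in lebesgue. \<forall>v\<in>V. v \<bullet> u \<noteq> 0"
    by (rule AE_off_hyperplanes) (auto simp: V_def)
  have rest_zero: "c Const = 0 \<and> (\<forall>i\<in>{1..k}. c (D2 i) = 0 \<and> c (D1 i) = 0 \<and> c (D0 i) = 0)"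
  proof (rule ccontr)
    assume neg: "\<not> ?thesis"
    \<comment> \<open>If these coefficients were not all zero, no generic \<open>u\<close> would
      exist and the constant 1 would vanish almost everywhere.\<close>
    have "AE u::real^'d::{finite,linorder} in lebesgue. (1::real) = 0" using AE_V by eventually_elim (use generic neg in blast)
    then show False using continuous_AE_lebesgue_zero[of "\<lambda>u::real^'d::{finite,linorder}. 1"] by auto
  qed
  have "Q i u = 0" if i: "i \<in> {1..k}" for i u
  proof (rule continuous_AE_lebesgue_zero[where f = "Q i"])
    show "continuous_on UNIV (Q i)"
      unfolding Q_def case_prod_unfold by (intro continuous_intros)
    show "AE u in lebesgue. Q i u = 0"
      using AE_V by eventually_elim (use generic i in blast)
  qed
  then have Quad: "c (Quad_D2 i l m) = 0" if "i \<in> {1..k}" "l \<le> m" for i l m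
    using quadratic_form_coeffs_zero[of "\<lambda>l m. c (Quad_D2 i l m)"] that by (simp add: Q_def)
  have "L i u = 0" if i: "i \<in> {1..k}" for i u
  proof (rule continuous_AE_lebesgue_zero[where f = "L i"])
    show "continuous_on UNIV (L i)"
      unfolding L_def by (intro continuous_intros)
    show "AE u in lebesgue. L i u = 0"
      using AE_V by eventually_elim (use generic i in blast)
  qed
  then have Lin: "c (Lin_D1 i m) = 0" if "i \<in> {1..k}" for i m
    using linear_form_coeffs_zero[of "\<lambda>m. c (Lin_D1 i m)"] that by (simp add: L_def)
  show ?thesis
    using \<open>j \<in> score_indices k\<close> rest_zero Quad Lin unfolding score_indices_def by auto
qed

theorem mainTheorem3:
  fixes \<eta> \<beta>0 :: real
    and k0 :: nat
    and a0 :: "nat \<Rightarrow> real"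
    and w0 :: "nat \<Rightarrow> real \<times> (real ^ 'd::{finite,linorder})"
    and q :: "real ^ 'd::{finite,linorder} \<Rightarrow> real"
  assumes "\<eta> > 0"
    and "minimal_mlp_function sigmoid k0 (mlp sigmoid k0 \<beta>0 a0 w0)"
    and "\<And>i. i \<in> {1..k0} \<Longrightarrow> norm (w0 i) \<ge> \<eta>"
    and "\<And>i. i \<in> {1..k0} \<Longrightarrow> a0 i \<ge> \<eta>"
    and "q \<in> borel_measurable lebesgue"
    and "\<And>x. q x > 0"
    and "prob_space (density lebesgue q)"
    and "integrable lebesgue (\<lambda>x. norm x ^ 6 * q x)"
  shows "lin_indep_L2 (density lebesgue q) (score_indices k0) (score_fun sigmoid w0)"
  unfolding lin_indep_L2_def
proof (intro conjI ballI allI impI)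
  fix j :: "'d score_index"
  show "score_fun sigmoid w0 j \<in> L2 (density lebesgue q)"
    using assms(5-8) continuous_score_fun_sigmoid abs_score_fun_sigmoid_le
    by (intro L2_density_lebesgue_cubic_growth) (auto simp: less_imp_le)
next
  fix J c and j :: "'d score_index"
  assume J: "finite J" "J \<subseteq> score_indices k0" "j \<in> J"
    and AE: "AE x in density lebesgue q. (\<Sum>j\<in>J. c j * score_fun sigmoid w0 j x) = 0"
  \<comment> \<open>Extension by zero turns a combination over \<open>J\<close> into one over all
    score indices.\<close>
  define c' where "c' = (\<lambda>j. if j \<in> J then c j else 0)"
  \<comment> \<open>Positivity of \<open>q\<close> makes null sets of the density Lebesgue null, so
    continuity then gives vanishing everywhere.\<close>
  have "AE x in lebesgue. (\<Sum>j\<in>J. c j * score_fun sigmoid w0 j x) = 0"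
    using AE assms(5,6) by (simp add: AE_density)
  then have "(\<Sum>j\<in>J. c j * score_fun sigmoid w0 j x) = 0" for x
    by (intro continuous_AE_lebesgue_zero) (auto intro!: continuous_intros continuous_score_fun_sigmoid)
  moreover have "(\<Sum>j\<in>score_indices k0. c' j * score_fun sigmoid w0 j x)
    = (\<Sum>j\<in>J. c j * score_fun sigmoid w0 j x)" for x
    using J(2) by (intro sum.mono_neutral_cong_right) (auto simp: c'_def finite_score_indices)
  ultimately have zero: "(\<Sum>j\<in>score_indices k0. c' j * score_fun sigmoid w0 j x) = 0" for x by simp
  have "c' j = 0"
  proof (rule sigmoid_score_combination_trivial[OF _ _ zero])
    show "snd (w0 i) \<noteq> 0" if "i \<in> {1..k0}" for i
      by (rule minimal_mlp_weight_nonconstant[OF assms(2) that])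
    show "w0 i \<noteq> w0 j \<and> w0 i \<noteq> - w0 j" if "i \<in> {1..k0}" "j \<in> {1..k0}" "i \<noteq> j" for i j
      \<comment> \<open>Equal weights give the affine relation with \<open>r\<close> = 0,
        \<open>s\<close> = 1; opposite weights give \<open>r\<close> = 1, \<open>s\<close> =
        -1.\<close>
      using minimal_mlp_weights_distinct[OF assms(2) that, of 0 1]
        minimal_mlp_weights_distinct[OF assms(2) that, of 1 "-1"]
      by (auto simp: sigmoid_uminus)
    show "j \<in> score_indices k0" using J by blast
  qed
  then show "c j = 0" using J(3) by (simp add: c'_def)
qed

end
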